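(* With respect to $\langle\,,\,\rangle$ the vectors $\tilde x^r\tilde y^s\tilde z^t$ ($r,s,t\ge 0$ integers, $r+s+t=N$) are mutually orthogonal, and for all such $r,s,t$ $$\langle\tilde x^r\tilde y^s\tilde z^t,\tilde x^r\tilde y^s\tilde z^t\rangle=\frac{r!\,s!\,t!}{\eta_0^r\eta_1^s\eta_2^t}\,\tilde\vartheta^N .$$
   Context: Let $p_1,p_2,p_3,p_4\in\mathbb C$ be such that all of $p_1,\ p_2,\ p_3,\ p_4,\ p_1+p_2,\ p_1+p_3,\ p_2+p_4,\ p_3+p_4,\ p_1+p_2+p_3+p_4,\ p_1p_4-p_2p_3$ are nonzero, and let $N\ge 0$ be an integer. Put $S=p_1+p_2+p_3+p_4$ and $$\mathbf t=\tfrac{(p_1+p_2)(p_1+p_3)}{p_1S},\quad \mathbf u=\tfrac{(p_1+p_3)(p_3+p_4)}{p_3S},\quad \mathbf v=\tfrac{(p_1+p_2)(p_2+p_4)}{p_2S},\quad \mathbf w=\tfrac{(p_2+p_4)(p_3+p_4)}{p_4S},$$ $$\nu=\tfrac{(p_1+p_2)(p_1+p_3)(p_2+p_4)(p_3+p_4)}{(p_1p_4-p_2p_3)^2},\qquad \eta_0=\tilde\eta_0=\nu^{-1},$$ $$\eta_1=\tfrac{p_1p_2S}{(p_1+p_2)(p_1+p_3)(p_2+p_4)},\quad \eta_2=\tfrac{p_3p_4S}{(p_1+p_3)(p_2+p_4)(p_3+p_4)},\quad \tilde\eta_1=\tfrac{p_1p_3S}{(p_1+p_2)(p_1+p_3)(p_3+p_4)},\quad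 \tilde\eta_2=\tfrac{p_2p_4S}{(p_1+p_2)(p_2+p_4)(p_3+p_4)},$$ $$\vartheta=\tfrac{(p_1+p_3)(p_2+p_4)}{p_2p_3-p_1p_4},\qquad \tilde\vartheta=\tfrac{(p_1+p_2)(p_3+p_4)}{p_2p_3-p_1p_4}.$$ Let $x,y,z$ be commuting indeterminates, and let $V$ be the space of homogeneous polynomials of total degree $N$ in $\mathbb C[x,y,z]$. Define $$\tilde x=\tilde\vartheta(\tilde\eta_0x+\tilde\eta_1y+\tilde\eta_2z),\quad \tilde y=\tilde\vartheta\big(\tilde\eta_0x+(1-\mathbf t)\tilde\eta_1y+(1-\mathbf v)\tilde\eta_2z\big),\quad \tilde z=\tilde\vartheta\big(\tilde\eta_0x+(1-\mathbf u)\tilde\eta_1y+(1-\mathbf w)\tilde\eta_2z\big).$$ Let $\langle\,,\,\rangle$ be the symmetric bilinear form on $V$ for which the monomials $x^ry^sz^t$ ($r,s,t\ge0$, $r+s+t=N$) are mutually orthogonal and $$\langle x^ry^sz^t,x^ry^sz^t\rangle=\frac{r!\,s!\,t!}{\tilde\eta_0^r\tilde\eta_1^s\tilde\eta_2^t}\,\vartheta^N .$$ *)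

theory Defs
  imports Complex_Main "HOL-Library.Poly_Mapping"
begin

text \<open>
  The polynomial ring in the three commuting indeterminates \<open>x\<close>, \<open>y\<close>, \<open>z\<close> over the
  complex numbers, as finitely supported maps from exponent vectors to coefficients; the product
  of \<open>Poly_Mapping\<close> is then the usual product of polynomials.
\<close>

datatype indet = VX | VY | VZ

type_synonym poly3 = "(indet \<Rightarrow>\<^sub>0 nat) \<Rightarrow>\<^sub>0 complex"

definition indet_poly :: "indet \<Rightarrow> poly3" where
  "indet_poly i = Poly_Mapping.single (Poly_Mapping.single i 1) 1"

abbreviation (input) PX :: poly3 where "PX \<equiv> indet_poly VX"
abbreviation (input) PY :: poly3 where "PY \<equiv> indet_poly VY"
abbreviation (input) PZ :: poly3 where "PZ \<equiv> indet_poly VZ"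

definition const_poly :: "complex \<Rightarrow> poly3" where
  "const_poly c = Poly_Mapping.single 0 c"

definition homog :: "nat \<Rightarrow> poly3 set" where
  "homog N = {f. \<forall>m\<in>Poly_Mapping.keys f.
     Poly_Mapping.lookup m VX + Poly_Mapping.lookup m VY + Poly_Mapping.lookup m VZ = N}"


definition par_t :: "complex \<Rightarrow> complex \<Rightarrow> complex \<Rightarrow> complex \<Rightarrow> complex" where
  "par_t p1 p2 p3 p4 = (p1 + p2) * (p1 + p3) / (p1 * (p1 + p2 + p3 + p4))"

definition par_u :: "complex \<Rightarrow> complex \<Rightarrow> complex \<Rightarrow> complex \<Rightarrow> complex" where
  "par_u p1 p2 p3 p4 = (p1 + p3) * (p3 + p4) / (p3 * (p1 + p2 + p3 + p4))"

definition par_v :: "complex \<Rightarrow> complex \<Rightarrow> complex \<Rightarrow> complex \<Rightarrow> complex" where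
  "par_v p1 p2 p3 p4 = (p1 + p2) * (p2 + p4) / (p2 * (p1 + p2 + p3 + p4))"

definition par_w :: "complex \<Rightarrow> complex \<Rightarrow> complex \<Rightarrow> complex \<Rightarrow> complex" where
  "par_w p1 p2 p3 p4 = (p2 + p4) * (p3 + p4) / (p4 * (p1 + p2 + p3 + p4))"

definition nu :: "complex \<Rightarrow> complex \<Rightarrow> complex \<Rightarrow> complex \<Rightarrow> complex" where
  "nu p1 p2 p3 p4 =
     (p1 + p2) * (p1 + p3) * (p2 + p4) * (p3 + p4) / (p1 * p4 - p2 * p3) ^ 2"

definition eta0 :: "complex \<Rightarrow> complex \<Rightarrow> complex \<Rightarrow> complex \<Rightarrow> complex" where
  "eta0 p1 p2 p3 p4 = inverse (nu p1 p2 p3 p4)"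

definition eta1 :: "complex \<Rightarrow> complex \<Rightarrow> complex \<Rightarrow> complex \<Rightarrow> complex" where
  "eta1 p1 p2 p3 p4 =
     p1 * p2 * (p1 + p2 + p3 + p4) / ((p1 + p2) * (p1 + p3) * (p2 + p4))"

definition eta2 :: "complex \<Rightarrow> complex \<Rightarrow> complex \<Rightarrow> complex \<Rightarrow> complex" where
  "eta2 p1 p2 p3 p4 =
     p3 * p4 * (p1 + p2 + p3 + p4) / ((p1 + p3) * (p2 + p4) * (p3 + p4))"

definition teta0 :: "complex \<Rightarrow> complex \<Rightarrow> complex \<Rightarrow> complex \<Rightarrow> complex" where
  "teta0 p1 p2 p3 p4 = inverse (nu p1 p2 p3 p4)"

definition teta1 :: "complex \<Rightarrow> complex \<Rightarrow> complex \<Rightarrow> complex \<Rightarrow> complex" where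
  "teta1 p1 p2 p3 p4 =
     p1 * p3 * (p1 + p2 + p3 + p4) / ((p1 + p2) * (p1 + p3) * (p3 + p4))"

definition teta2 :: "complex \<Rightarrow> complex \<Rightarrow> complex \<Rightarrow> complex \<Rightarrow> complex" where
  "teta2 p1 p2 p3 p4 =
     p2 * p4 * (p1 + p2 + p3 + p4) / ((p1 + p2) * (p2 + p4) * (p3 + p4))"

definition theta :: "complex \<Rightarrow> complex \<Rightarrow> complex \<Rightarrow> complex \<Rightarrow> complex" where
  "theta p1 p2 p3 p4 = (p1 + p3) * (p2 + p4) / (p2 * p3 - p1 * p4)"

definition ttheta :: "complex \<Rightarrow> complex \<Rightarrow> complex \<Rightarrow> complex \<Rightarrow> complex" where
  "ttheta p1 p2 p3 p4 = (p1 + p2) * (p3 + p4) / (p2 * p3 - p1 * p4)"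


definition tx :: "complex \<Rightarrow> complex \<Rightarrow> complex \<Rightarrow> complex \<Rightarrow> poly3" where
  "tx p1 p2 p3 p4 = const_poly (ttheta p1 p2 p3 p4) *
     (const_poly (teta0 p1 p2 p3 p4) * PX
      + const_poly (teta1 p1 p2 p3 p4) * PY
      + const_poly (teta2 p1 p2 p3 p4) * PZ)"

definition ty :: "complex \<Rightarrow> complex \<Rightarrow> complex \<Rightarrow> complex \<Rightarrow> poly3" where
  "ty p1 p2 p3 p4 = const_poly (ttheta p1 p2 p3 p4) *
     (const_poly (teta0 p1 p2 p3 p4) * PX
      + const_poly ((1 - par_t p1 p2 p3 p4) * teta1 p1 p2 p3 p4) * PY
      + const_poly ((1 - par_v p1 p2 p3 p4) * teta2 p1 p2 p3 p4) * PZ)"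

definition tz :: "complex \<Rightarrow> complex \<Rightarrow> complex \<Rightarrow> complex \<Rightarrow> poly3" where
  "tz p1 p2 p3 p4 = const_poly (ttheta p1 p2 p3 p4) *
     (const_poly (teta0 p1 p2 p3 p4) * PX
      + const_poly ((1 - par_u p1 p2 p3 p4) * teta1 p1 p2 p3 p4) * PY
      + const_poly ((1 - par_w p1 p2 p3 p4) * teta2 p1 p2 p3 p4) * PZ)"


text \<open>
  Forms are total functions here; only their values on \<open>homog N\<close> are constrained.  The form is
  complex bilinear, with no conjugation; linearity in the second argument follows by symmetry.
\<close>

definition sym_bilinear_on :: "poly3 set \<Rightarrow> (poly3 \<Rightarrow> poly3 \<Rightarrow> complex) \<Rightarrow> bool" where
  "sym_bilinear_on V B \<longleftrightarrow>
     (\<forall>f\<in>V. \<forall>g\<in>V. B f g = B g f) \<and>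
     (\<forall>f\<in>V. \<forall>g\<in>V. \<forall>h\<in>V. B (f + g) h = B f h + B g h) \<and>
     (\<forall>c. \<forall>f\<in>V. \<forall>g\<in>V. B (const_poly c * f) g = c * B f g)"

definition is_the_form ::
  "complex \<Rightarrow> complex \<Rightarrow> complex \<Rightarrow> complex \<Rightarrow> nat \<Rightarrow> (poly3 \<Rightarrow> poly3 \<Rightarrow> complex) \<Rightarrow> bool" where
  "is_the_form p1 p2 p3 p4 N B \<longleftrightarrow>
     sym_bilinear_on (homog N) B \<and>
     (\<forall>r s t r' s' t'. r + s + t = N \<longrightarrow> r' + s' + t' = N \<longrightarrow> (r, s, t) \<noteq> (r', s', t') \<longrightarrow>
        B (PX ^ r * PY ^ s * PZ ^ t) (PX ^ r' * PY ^ s' * PZ ^ t') = 0) \<and>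
     (\<forall>r s t. r + s + t = N \<longrightarrow>
        B (PX ^ r * PY ^ s * PZ ^ t) (PX ^ r * PY ^ s * PZ ^ t) =
          fact r * fact s * fact t
          / (teta0 p1 p2 p3 p4 ^ r * teta1 p1 p2 p3 p4 ^ s * teta2 p1 p2 p3 p4 ^ t)
          * theta p1 p2 p3 p4 ^ N)"


text \<open>
  There is exactly one such form, up to its irrelevant values outside \<open>homog N\<close>.
\<close>

definition expo :: "nat \<Rightarrow> nat \<Rightarrow> nat \<Rightarrow> (indet \<Rightarrow>\<^sub>0 nat)" where
  "expo r s t =
     Poly_Mapping.single VX r + Poly_Mapping.single VY s + Poly_Mapping.single VZ t"

lemma lookup_expo:
  "Poly_Mapping.lookup (expo r s t) VX = r"
  "Poly_Mapping.lookup (expo r s t) VY = s"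
  "Poly_Mapping.lookup (expo r s t) VZ = t"
  by (simp_all add: expo_def lookup_add lookup_single)

lemma expo_eq_iff: "expo r s t = expo r' s' t' \<longleftrightarrow> r = r' \<and> s = s' \<and> t = t'"
  by (metis lookup_expo)

lemma expo_lookup:
  "expo (Poly_Mapping.lookup m VX) (Poly_Mapping.lookup m VY) (Poly_Mapping.lookup m VZ) = m"
proof (rule poly_mapping_eqI)
  fix i show "Poly_Mapping.lookup (expo (Poly_Mapping.lookup m VX)
    (Poly_Mapping.lookup m VY) (Poly_Mapping.lookup m VZ)) i = Poly_Mapping.lookup m i"
    by (cases i) (simp_all add: lookup_expo)
qed

lemma indet_power: "indet_poly i ^ n = Poly_Mapping.single (Poly_Mapping.single i n) 1"
  by (induction n) (simp_all add: indet_poly_def mult_single flip: single_add)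

lemma monomial_eq: "PX ^ r * PY ^ s * PZ ^ t = Poly_Mapping.single (expo r s t) 1"
  by (simp add: indet_power mult_single expo_def)

lemma lookup_const_mult: "Poly_Mapping.lookup (const_poly c * f) m = c * Poly_Mapping.lookup f m"
proof -
  have "const_poly c * f = Poly_Mapping.map ((*) c) f"
    unfolding const_poly_def by (rule mult_map_scale_conv_mult[symmetric])
  then show ?thesis by (simp add: map.rep_eq when_def)
qed

lemma homog_add: "f \<in> homog N \<Longrightarrow> g \<in> homog N \<Longrightarrow> f + g \<in> homog N"
  using keys_add[of f g] unfolding homog_def by blast

lemma homog_const_mult: "f \<in> homog N \<Longrightarrow> const_poly c * f \<in> homog N"
  unfolding homog_def by (auto simp: in_keys_iff lookup_const_mult)

lemma homog_zero: "0 \<in> homog N"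
  by (simp add: homog_def)

lemma homog_monomial: "r + s + t = N \<Longrightarrow> Poly_Mapping.single (expo r s t) 1 \<in> homog N"
  by (simp add: homog_def lookup_expo)

lemma is_the_form_exists: "\<exists>B. is_the_form p1 p2 p3 p4 N B"
proof -
  define T where "T = {(r, s, t). r + s + t = N}"
  define W where "W = (\<lambda>(r, s, t). (fact r * fact s * fact t
          / (teta0 p1 p2 p3 p4 ^ r * teta1 p1 p2 p3 p4 ^ s * teta2 p1 p2 p3 p4 ^ t)
          * theta p1 p2 p3 p4 ^ N :: complex))"
  define L where "L = (\<lambda>(f :: poly3) (r, s, t). Poly_Mapping.lookup f (expo r s t))"
  define B where "B = (\<lambda>f g. \<Sum>k\<in>T. L f k * L g k * W k)"
  have fin: "finite T"
    by (rule finite_subset[of _ "{..N} \<times> {..N} \<times> {..N}"]) (auto simp: T_def)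
  have L_single: "L (Poly_Mapping.single (expo r s t) 1) k = (if k = (r, s, t) then 1 else 0)"
    for r s t k
    by (auto simp: L_def lookup_single when_def expo_eq_iff split: prod.splits)
  have L_add: "L (f + g) k = L f k + L g k" for f g k
    by (simp add: L_def lookup_add split: prod.splits)
  have L_const: "L (const_poly c * f) k = c * L f k" for c f k
    by (simp add: L_def lookup_const_mult split: prod.splits)
  have "sym_bilinear_on (homog N) B"
    unfolding sym_bilinear_on_def
  proof (intro conjI ballI allI)
    fix f g h c
    show "B f g = B g f"
      unfolding B_def by (rule sum.cong) simp_all
    show "B (f + g) h = B f h + B g h"
      unfolding B_def by (simp only: L_add distrib_right sum.distrib)
    show "B (const_poly c * f) g = c * B f g"
      unfolding B_def by (simp only: L_const sum_distrib_left mult.assoc)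
  qed
  moreover have "B (Poly_Mapping.single (expo r s t) 1) (Poly_Mapping.single (expo r' s' t') 1) =
      (if (r, s, t) = (r', s', t') then W (r, s, t) else 0)" if "r + s + t = N" for r s t r' s' t'
  proof -
    have "B (Poly_Mapping.single (expo r s t) 1) (Poly_Mapping.single (expo r' s' t') 1) =
      (\<Sum>k\<in>T. if k = (r, s, t) then (if k = (r', s', t') then W k else 0) else 0)"
      unfolding B_def by (rule sum.cong) (simp_all add: L_single)
    also have "\<dots> = (if (r, s, t) = (r', s', t') then W (r, s, t) else 0)"
      using fin that by (simp add: T_def sum.delta)
    finally show ?thesis .
  qed
  ultimately have "is_the_form p1 p2 p3 p4 N B"
    unfolding is_the_form_def monomial_eq by (simp add: W_def)
  then show ?thesis by (rule exI[of _ B])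
qed

lemma homog_induct [consumes 1, case_names zero add]:
  assumes "f \<in> homog N"
    and "P 0"
    and "\<And>c r s t g. r + s + t = N \<Longrightarrow> g \<in> homog N \<Longrightarrow> P g \<Longrightarrow>
           P (const_poly c * Poly_Mapping.single (expo r s t) 1 + g)"
  shows "P f"
proof -
  have "f \<in> homog N \<longrightarrow> P f" if "finite K" "Poly_Mapping.keys f = K" for K f
    using that
  proof (induction K arbitrary: f rule: finite_induct)
    case empty
    then show ?case using assms(2) by simp
  next
    case (insert m K)
    show ?case
    proof
      assume f: "f \<in> homog N"
      define c where "c = Poly_Mapping.lookup f m"
      define g where "g = f - Poly_Mapping.single m c"
      have keys: "Poly_Mapping.keys g = K"
      proof (rule set_eqI)
        fix k
        have "k \<in> Poly_Mapping.keys f \<longleftrightarrow> k = m \<or> k \<in> K"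
          unfolding insert.prems by simp
        then have "Poly_Mapping.lookup f k \<noteq> 0 \<longleftrightarrow> k = m \<or> k \<in> K"
          by (simp only: in_keys_iff)
        moreover have "Poly_Mapping.lookup g k = (if k = m then 0 else Poly_Mapping.lookup f k)"
          by (simp add: g_def c_def lookup_minus lookup_single when_def)
        ultimately show "k \<in> Poly_Mapping.keys g \<longleftrightarrow> k \<in> K"
          using insert.hyps(2) unfolding in_keys_iff by auto
      qed
      have g: "g \<in> homog N"
        using f keys insert.prems by (auto simp: homog_def)
      define r s t where "r = Poly_Mapping.lookup m VX" and "s = Poly_Mapping.lookup m VY"
        and "t = Poly_Mapping.lookup m VZ"
      have m: "expo r s t = m" by (simp add: r_def s_def t_def expo_lookup)
      have sum: "r + s + t = N"
        using f insert.prems by (simp add: homog_def r_def s_def t_def)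
      have "const_poly c * Poly_Mapping.single (expo r s t) 1 + g = f"
        by (simp add: const_poly_def mult_single m g_def)
      moreover have "P g" using insert.IH[OF keys] g by blast
      ultimately show "P f" using assms(3)[OF sum g, of c] by simp
    qed
  qed
  from this[OF finite_keys refl] show ?thesis using assms(1) by blast
qed

lemma is_the_form_unique:
  assumes B: "is_the_form p1 p2 p3 p4 N B" and B': "is_the_form p1 p2 p3 p4 N B'"
    and f: "f \<in> homog N" and g: "g \<in> homog N"
  shows "B f g = B' f g"
proof -
  have form_sym: "C f g = C g f"
    if "is_the_form p1 p2 p3 p4 N C" "f \<in> homog N" "g \<in> homog N" for C f g
    using that unfolding is_the_form_def sym_bilinear_on_def by blast
  have form_add: "C (f + g) h = C f h + C g h"
    if "is_the_form p1 p2 p3 p4 N C" "f \<in> homog N" "g \<in> homog N" "h \<in> homog N" for C f g h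
    using that unfolding is_the_form_def sym_bilinear_on_def by blast
  have form_scale: "C (const_poly c * f) g = c * C f g"
    if "is_the_form p1 p2 p3 p4 N C" "f \<in> homog N" "g \<in> homog N" for C f g c
    using that unfolding is_the_form_def sym_bilinear_on_def by blast
  have form_zero: "C 0 g = 0" if "is_the_form p1 p2 p3 p4 N C" "g \<in> homog N" for C g
    using form_scale[OF that(1) homog_zero that(2), of 0]
    by (simp add: const_poly_def)
  have mono: "B (Poly_Mapping.single (expo r s t) 1) (Poly_Mapping.single (expo r' s' t') 1) =
      B' (Poly_Mapping.single (expo r s t) 1) (Poly_Mapping.single (expo r' s' t') 1)"
    if "r + s + t = N" "r' + s' + t' = N" for r s t r' s' t'
    using B B' that unfolding is_the_form_def monomial_eq
    by (cases "(r, s, t) = (r', s', t')") auto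
  have step: "B f g = B' f g" if f: "f \<in> homog N" and g: "g \<in> homog N"
    and mono: "\<And>r s t. r + s + t = N \<Longrightarrow> B (Poly_Mapping.single (expo r s t) 1) g =
       B' (Poly_Mapping.single (expo r s t) 1) g" for f g
    using f
  proof (induction f rule: homog_induct)
    case zero
    then show ?case using form_zero[OF B g] form_zero[OF B' g] by simp
  next
    case (add c r s t h)
    let ?m = "Poly_Mapping.single (expo r s t) 1 :: poly3"
    have m: "?m \<in> homog N" by (rule homog_monomial[OF add.hyps(1)])
    have expand: "C (const_poly c * ?m + h) g = c * C ?m g + C h g"
      if "is_the_form p1 p2 p3 p4 N C" for C
      using form_add[OF that homog_const_mult[OF m] add.hyps(2) g] form_scale[OF that m g] by simp
    show ?case
      by (simp only: expand[OF B] expand[OF B'] add.IH mono[OF add.hyps(1)])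
  qed
  show ?thesis
  proof (rule step[OF f g])
    fix r s t assume rst: "r + s + t = N"
    let ?m = "Poly_Mapping.single (expo r s t) 1 :: poly3"
    have m: "?m \<in> homog N" by (rule homog_monomial[OF rst])
    have "B g ?m = B' g ?m"
      by (rule step[OF g m]) (rule mono[OF _ rst])
    then show "B ?m g = B' ?m g"
      using form_sym[OF B m g] form_sym[OF B' m g] by simp
  qed
qed

end

theory Submission
  imports Defs
begin

text \<open>
  Let \<open>a i\<close> be the squared length of the \<open>i\<close>-th indeterminate in degree 1. For the form in which
  distinct monomials are orthogonal and \<open>x\<^sup>m\<close> has squared length \<open>\<Prod>i. m i! * a i ^ m i\<close>,
  multiplication by a linear form \<open>u\<close> is adjoint to the derivation \<open>\<Sum>i. a i * u i * \<partial>\<^sub>i\<close>, which sends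
  a linear form \<open>v\<close> to the scalar product of \<open>u\<close> and \<open>v\<close>. If \<open>u\<^sub>1, u\<^sub>2, \<dots>\<close> are pairwise orthogonal
  linear forms, the derivation dual to \<open>u\<^sub>k\<close> therefore acts on their monomials as a multiple of
  \<open>\<partial>/\<partial>u\<^sub>k\<close>, and induction on the degree shows that these monomials are again orthogonal, with squared
  lengths given by the same formula. This reduces the claim to \<open>N = 1\<close>, where it amounts to six
  rational identities in \<open>p\<^sub>1, \<dots>, p\<^sub>4\<close>.
\<close>

section \<open>Partial derivatives\<close>

definition var :: "'i \<Rightarrow> ('i \<Rightarrow>\<^sub>0 nat) \<Rightarrow>\<^sub>0 'a::comm_semiring_1" where
  "var i = Poly_Mapping.single (Poly_Mapping.single i 1) 1"

text \<open>The formal partial derivative, given by coefficients. Differentiating the term with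
  exponent m + e_i, where e_i is \<open>Poly_Mapping.single i 1\<close>, contributes to m with the
  factor m_i + 1. The support stays finite because the shift by e_i is injective.\<close>

lift_definition pdiff :: "'i \<Rightarrow> (('i \<Rightarrow>\<^sub>0 nat) \<Rightarrow>\<^sub>0 'a::comm_semiring_1) \<Rightarrow> ('i \<Rightarrow>\<^sub>0 nat) \<Rightarrow>\<^sub>0 'a"
  is "\<lambda>i f m. of_nat (Suc (Poly_Mapping.lookup m i)) * f (Poly_Mapping.single i 1 + m)"
proof -
  fix i :: 'i and f :: "('i \<Rightarrow>\<^sub>0 nat) \<Rightarrow> 'a"
  assume fin: "finite {m. f m \<noteq> 0}"
  have "finite ((+) (Poly_Mapping.single i 1) -` {m. f m \<noteq> 0})"
    by (rule finite_vimageI[OF fin]) (simp add: inj_on_def)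
  then show "finite {m. of_nat (Suc (Poly_Mapping.lookup m i)) * f (Poly_Mapping.single i 1 + m) \<noteq> 0}"
    by (rule rev_finite_subset) auto
qed

lemma lookup_single_zero_mult:
  fixes f :: "'k::monoid_add \<Rightarrow>\<^sub>0 'a::comm_semiring_1"
  shows "Poly_Mapping.lookup (Poly_Mapping.single 0 c * f) m = c * Poly_Mapping.lookup f m"
  by (simp add: map.rep_eq when_def flip: mult_map_scale_conv_mult)

lemma single_zero_mult_mult:
  fixes f :: "'k::monoid_add \<Rightarrow>\<^sub>0 'a::comm_semiring_1"
  shows "Poly_Mapping.single 0 x * (Poly_Mapping.single 0 y * f) = Poly_Mapping.single 0 (x * y) * f"
  by (simp add: mult_single flip: mult.assoc)

text \<open>Subtraction of exponents is truncated, so m - e_i undoes a shift by e_i only if m_i > 0;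
  otherwise m is not of the form e_i + q.\<close>

lemma lookup_var_mult:
  "Poly_Mapping.lookup (var i * f) m =
    (if Poly_Mapping.lookup m i = 0 then 0 else Poly_Mapping.lookup f (m - Poly_Mapping.single i 1))"
proof -
  have *: "m = Poly_Mapping.single i 1 + q \<longleftrightarrow> Poly_Mapping.lookup m i \<noteq> 0 \<and> q = m - Poly_Mapping.single i 1" for q
  proof
    assume "Poly_Mapping.lookup m i \<noteq> 0 \<and> q = m - Poly_Mapping.single i 1"
    then show "m = Poly_Mapping.single i 1 + q"
      by (intro poly_mapping_eqI) (auto simp: lookup_add lookup_minus lookup_single when_def)
  qed (simp add: lookup_add)
  have "Poly_Mapping.lookup (var i * f) m = (\<Sum>q. Poly_Mapping.lookup f q when m = Poly_Mapping.single i 1 + q)"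
    by (simp add: var_def lookup_mult lookup_single when_mult)
  also have "\<dots> = (if Poly_Mapping.lookup m i = 0 then 0 else Poly_Mapping.lookup f (m - Poly_Mapping.single i 1))"
    unfolding * by (cases "Poly_Mapping.lookup m i = 0") (simp_all del: One_nat_def)
  finally show ?thesis .
qed

lemma lookup_var_mult_add: "Poly_Mapping.lookup (var i * f) (Poly_Mapping.single i 1 + m) = Poly_Mapping.lookup f m"
  by (simp add: lookup_var_mult lookup_add)

lemma pdiff_add: "pdiff i (f + g) = pdiff i f + pdiff i g"
  by (rule poly_mapping_eqI) (simp add: pdiff.rep_eq lookup_add algebra_simps)

lemma pdiff_zero [simp]: "pdiff i 0 = 0"
  by (rule poly_mapping_eqI) (simp add: pdiff.rep_eq)

lemma pdiff_sum: "pdiff i (sum f A) = (\<Sum>x\<in>A. pdiff i (f x))"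
  by (induction A rule: infinite_finite_induct) (simp_all add: pdiff_add)

lemma pdiff_one [simp]: "pdiff i 1 = 0"
proof (rule poly_mapping_eqI)
  fix m :: "'a \<Rightarrow>\<^sub>0 nat"
  have "Poly_Mapping.single i 1 + m \<noteq> 0"
    by (metis add_eq_0_iff_both_eq_0 lookup_add lookup_single_eq lookup_zero one_neq_zero)
  then show "Poly_Mapping.lookup (pdiff i 1) m = Poly_Mapping.lookup 0 m"
    by (simp add: pdiff.rep_eq lookup_one)
qed

lemma pdiff_const_mult:
  "pdiff i (Poly_Mapping.single 0 c * f) = Poly_Mapping.single 0 c * pdiff i f"
  by (rule poly_mapping_eqI) (simp add: pdiff.rep_eq lookup_single_zero_mult mult.left_commute)

text \<open>The Leibniz rule with a variable as one factor; by linearity it extends to linear forms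
  as factors.\<close>

lemma pdiff_var_mult: "pdiff j (var i * f) = (if i = j then f else 0) + var i * pdiff j f"
proof (rule poly_mapping_eqI)
  fix m :: "'a \<Rightarrow>\<^sub>0 nat"
  \<comment> \<open>Truncated subtraction of e_i commutes with adding e_j once m_i >= 1. If m_i = 0,
    the second summand of the claim vanishes at m.\<close>
  have "Poly_Mapping.single j 1 + m - Poly_Mapping.single i 1 =
    Poly_Mapping.single j 1 + (m - Poly_Mapping.single i 1)" if "1 \<le> Poly_Mapping.lookup m i"
    using that
    by (intro poly_mapping_eqI)
      (auto simp: lookup_add lookup_minus lookup_single when_def simp del: One_nat_def)
  then show "Poly_Mapping.lookup (pdiff j (var i * f)) m = Poly_Mapping.lookup ((if i = j then f else 0) + var i * pdiff j f) m"
    by (cases "Poly_Mapping.lookup m i")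
      (auto simp: pdiff.rep_eq lookup_var_mult lookup_add lookup_minus lookup_single distrib_right
        simp del: One_nat_def)
qed

section \<open>Linear forms and their dual derivations\<close>

definition lin_form :: "('i::finite \<Rightarrow> 'a) \<Rightarrow> ('i \<Rightarrow>\<^sub>0 nat) \<Rightarrow>\<^sub>0 'a::comm_semiring_1" where
  "lin_form u = (\<Sum>i\<in>UNIV. Poly_Mapping.single 0 (u i) * var i)"

definition dual_diff ::
    "('i::finite \<Rightarrow> 'a) \<Rightarrow> ('i \<Rightarrow> 'a) \<Rightarrow> (('i \<Rightarrow>\<^sub>0 nat) \<Rightarrow>\<^sub>0 'a) \<Rightarrow> ('i \<Rightarrow>\<^sub>0 nat) \<Rightarrow>\<^sub>0 'a::comm_semiring_1" where
  "dual_diff a u f = (\<Sum>i\<in>UNIV. Poly_Mapping.single 0 (a i * u i) * pdiff i f)"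

text \<open>The scalar product of \<open>lin_form u\<close> and \<open>lin_form v\<close> under
  \<open>mono_form a\<close>, in coordinates.\<close>

definition pairing :: "('i::finite \<Rightarrow> 'a) \<Rightarrow> ('i \<Rightarrow> 'a) \<Rightarrow> ('i \<Rightarrow> 'a) \<Rightarrow> 'a::comm_semiring_1" where
  "pairing a u v = (\<Sum>i\<in>UNIV. a i * u i * v i)"

lemma dual_diff_one [simp]: "dual_diff a u 1 = 0"
  by (simp add: dual_diff_def)

lemma dual_diff_lin_form_mult:
  "dual_diff a u (lin_form v * f) =
    Poly_Mapping.single 0 (pairing a u v) * f + lin_form v * dual_diff a u f"
proof -
  have sum0: "Poly_Mapping.single 0 (sum h A) = (\<Sum>x\<in>A. Poly_Mapping.single 0 (h x))"
    for h :: "'a \<Rightarrow> 'b" and A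
    by (induction A rule: infinite_finite_induct) (simp_all add: single_add)
  have "pdiff i (lin_form v * f) = Poly_Mapping.single 0 (v i) * f + lin_form v * pdiff i f" for i
  proof -
    have "pdiff i (lin_form v * f) =
        (\<Sum>j\<in>UNIV. Poly_Mapping.single 0 (v j) * ((if j = i then f else 0) + var j * pdiff i f))"
      by (simp add: lin_form_def sum_distrib_right pdiff_sum mult.assoc pdiff_const_mult pdiff_var_mult)
    also have "\<dots> = (\<Sum>j\<in>UNIV. if j = i then Poly_Mapping.single 0 (v j) * f else 0) +
        (\<Sum>j\<in>UNIV. Poly_Mapping.single 0 (v j) * var j * pdiff i f)"
      unfolding sum.distrib[symmetric] by (rule sum.cong) (auto simp: algebra_simps)
    finally show ?thesis
      by (simp add: lin_form_def sum_distrib_right)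
  qed
  then show ?thesis
    by (simp add: single_zero_mult_mult dual_diff_def pairing_def sum0 sum_distrib_left sum_distrib_right sum.distrib
      distrib_left mult.left_commute[of _ "lin_form v"])
qed

section \<open>The form with orthogonal monomials\<close>

text \<open>The factorial is taken in the natural numbers and then embedded, since the coefficients
  form only a commutative semiring.\<close>

definition mono_weight :: "('i::finite \<Rightarrow> 'a) \<Rightarrow> ('i \<Rightarrow>\<^sub>0 nat) \<Rightarrow> 'a::comm_semiring_1" where
  "mono_weight a m = (\<Prod>i\<in>UNIV. of_nat (fact (Poly_Mapping.lookup m i)) * a i ^ Poly_Mapping.lookup m i)"

text \<open>Defined on all polynomials at once, because the adjunction below links different
  degrees. Summing over the support of \<open>f\<close> alone loses nothing, as all other terms
  vanish.\<close>

definition mono_form ::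
    "('i::finite \<Rightarrow> 'a) \<Rightarrow> (('i \<Rightarrow>\<^sub>0 nat) \<Rightarrow>\<^sub>0 'a) \<Rightarrow> (('i \<Rightarrow>\<^sub>0 nat) \<Rightarrow>\<^sub>0 'a) \<Rightarrow> 'a::comm_semiring_1" where
  "mono_form a f g = (\<Sum>m\<in>Poly_Mapping.keys f. Poly_Mapping.lookup f m * Poly_Mapping.lookup g m * mono_weight a m)"

text \<open>This ratio of weights contains exactly the factor m_i + 1 that occurs in
  \<open>pdiff\<close>, which is why the factorials are in the weights.\<close>

lemma mono_weight_add_single:
  "mono_weight a (Poly_Mapping.single i 1 + m) = of_nat (Suc (Poly_Mapping.lookup m i)) * a i * mono_weight a m"
proof -
  have "mono_weight a (Poly_Mapping.single i 1 + m) =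
      (\<Prod>j\<in>UNIV. (if j = i then of_nat (Suc (Poly_Mapping.lookup m i)) * a i else 1) *
        (of_nat (fact (Poly_Mapping.lookup m j)) * a j ^ Poly_Mapping.lookup m j))"
    unfolding mono_weight_def
    by (rule prod.cong) (auto simp: lookup_add lookup_single algebra_simps)
  then show ?thesis
    by (simp add: prod.distrib mono_weight_def)
qed

lemma mono_form_eq_sum:
  assumes "finite A" and "Poly_Mapping.keys f \<subseteq> A"
  shows "mono_form a f g = (\<Sum>m\<in>A. Poly_Mapping.lookup f m * Poly_Mapping.lookup g m * mono_weight a m)"
  unfolding mono_form_def using assms
  by (intro sum.mono_neutral_left) (auto simp: in_keys_iff)

lemma mono_form_commute: "mono_form a f g = mono_form a g f"
  by (simp add: mono_form_eq_sum[of "Poly_Mapping.keys f \<union> Poly_Mapping.keys g"] mult.commute)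

lemma mono_form_add_right: "mono_form a f (g + h) = mono_form a f g + mono_form a f h"
  by (simp add: mono_form_def lookup_add algebra_simps sum.distrib)

lemma mono_form_const_mult_right:
  "mono_form a f (Poly_Mapping.single 0 c * g) = c * mono_form a f g"
  by (simp add: mono_form_def lookup_single_zero_mult sum_distrib_left mult.assoc mult.left_commute)

lemma mono_form_sum_right: "mono_form a f (sum g A) = (\<Sum>x\<in>A. mono_form a f (g x))"
  by (induction A rule: infinite_finite_induct)
    (simp_all add: mono_form_add_right, simp_all add: mono_form_def)

lemma mono_form_one: "mono_form a 1 1 = 1"
  by (simp add: mono_form_def mono_weight_def)

text \<open>Multiplication by \<open>var i\<close> shifts the support by e_i. After reindexing the
  sum, the ratio of weights turns the shifted coefficients of \<open>g\<close> into those of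
  \<open>pdiff i g\<close>, with \<open>a i\<close> left over.\<close>

lemma mono_form_var_mult: "mono_form a (var i * f) g = a i * mono_form a f (pdiff i g)"
proof -
  let ?e = "(+) (Poly_Mapping.single i 1)"
  have "Poly_Mapping.keys (var i * f) \<subseteq> ?e ` Poly_Mapping.keys f"
    using keys_mult[of "var i" f] by (auto simp: var_def)
  then have "mono_form a (var i * f) g =
      (\<Sum>m\<in>?e ` Poly_Mapping.keys f. Poly_Mapping.lookup (var i * f) m * Poly_Mapping.lookup g m * mono_weight a m)"
    by (intro mono_form_eq_sum) simp_all
  also have "\<dots> = (\<Sum>m\<in>Poly_Mapping.keys f. Poly_Mapping.lookup f m * Poly_Mapping.lookup g (?e m) * mono_weight a (?e m))"
    by (subst sum.reindex) (simp_all add: inj_on_def lookup_var_mult_add del: One_nat_def)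
  also have "\<dots> = a i * mono_form a f (pdiff i g)"
    unfolding mono_form_def sum_distrib_left mono_weight_add_single pdiff.rep_eq
    by (simp only: mult_ac)
  finally show ?thesis .
qed

lemma mono_form_lin_form_mult: "mono_form a (lin_form u * f) g = mono_form a f (dual_diff a u g)"
proof -
  have "mono_form a (lin_form u * f) g = (\<Sum>i\<in>UNIV. u i * mono_form a (var i * f) g)"
    by (simp add: lin_form_def sum_distrib_right mult.assoc mono_form_commute[of _ _ g]
      mono_form_sum_right mono_form_const_mult_right)
  then show ?thesis
    by (simp add: mono_form_var_mult dual_diff_def mono_form_sum_right mono_form_const_mult_right
      mult.assoc mult.left_commute)
qed

section \<open>Monomials in orthogonal linear forms\<close>

definition lin_prod ::
    "('j::finite \<Rightarrow> 'i::finite \<Rightarrow> 'a) \<Rightarrow> ('j \<Rightarrow> nat) \<Rightarrow> ('i \<Rightarrow>\<^sub>0 nat) \<Rightarrow>\<^sub>0 'a::comm_semiring_1" where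
  "lin_prod u r = (\<Prod>j\<in>UNIV. lin_form (u j) ^ r j)"

lemma lin_prod_remove:
  "lin_prod u r = lin_form (u k) ^ r k * (\<Prod>j\<in>UNIV - {k}. lin_form (u j) ^ r j)"
  unfolding lin_prod_def by (rule prod.remove) simp_all

lemma lin_prod_Suc:
  assumes "r k = Suc n"
  shows "lin_prod u r = lin_form (u k) * lin_prod u (r(k := n))"
  by (simp add: lin_prod_remove[of u _ k] assms mult.assoc)

text \<open>The power rule, with \<open>f\<close> a constant of the derivation. At
  \<open>n = 0\<close> the truncated exponent is harmless because the coefficient is zero.\<close>

lemma dual_diff_power_mult:
  assumes "dual_diff a u f = 0"
  shows "dual_diff a u (lin_form v ^ n * f) =
    Poly_Mapping.single 0 (of_nat n * pairing a u v) * (lin_form v ^ (n - 1) * f)"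
proof (induction n)
  case 0
  then show ?case using assms by simp
next
  case (Suc n)
  have "dual_diff a u (lin_form v ^ Suc n * f) =
      Poly_Mapping.single 0 (pairing a u v) * (lin_form v ^ n * f) +
      Poly_Mapping.single 0 (of_nat n * pairing a u v) * (lin_form v * lin_form v ^ (n - 1) * f)"
    unfolding power_Suc mult.assoc dual_diff_lin_form_mult Suc by (simp only: mult.left_commute)
  also have "\<dots> = Poly_Mapping.single 0 (of_nat (Suc n) * pairing a u v) * (lin_form v ^ n * f)"
    by (cases n) (simp_all add: distrib_right single_add)
  finally show ?case by simp
qed

lemma dual_diff_prod_eq_0:
  assumes "\<And>j. j \<in> A \<Longrightarrow> pairing a u (v j) = 0"
  shows "dual_diff a u (\<Prod>j\<in>A. lin_form (v j) ^ r j) = 0"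
  using assms
  by (induction A rule: infinite_finite_induct) (simp_all add: dual_diff_power_mult)

text \<open>By orthogonality the derivation kills every factor except the power of
  \<open>lin_form (u k)\<close>, to which the power rule applies.\<close>

lemma dual_diff_lin_prod:
  assumes orth: "\<And>j k. j \<noteq> k \<Longrightarrow> pairing a (u j) (u k) = 0"
  shows "dual_diff a (u k) (lin_prod u r) =
    Poly_Mapping.single 0 (of_nat (r k) * pairing a (u k) (u k)) * lin_prod u (r(k := r k - 1))"
proof -
  have "dual_diff a (u k) (\<Prod>j\<in>UNIV - {k}. lin_form (u j) ^ r j) = 0"
    by (rule dual_diff_prod_eq_0) (use orth in auto)
  from dual_diff_power_mult[OF this] show ?thesis
    by (simp add: lin_prod_remove[of u _ k])
qed

lemma mono_form_lin_prod:
  assumes orth: "\<And>j k. j \<noteq> k \<Longrightarrow> pairing a (u j) (u k) = 0"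
    and "sum r UNIV = sum s UNIV"
  shows "mono_form a (lin_prod u r) (lin_prod u s) =
    (if r = s then \<Prod>j\<in>UNIV. of_nat (fact (r j)) * pairing a (u j) (u j) ^ r j else 0)"
  using assms(2)
proof (induction "sum r UNIV" arbitrary: r s)
  case 0
  then have "r = (\<lambda>_. 0)" "s = (\<lambda>_. 0)" by auto
  then show ?case by (simp add: lin_prod_def mono_form_one)
next
  case (Suc N)
  obtain k where "r k \<noteq> 0"
    using Suc.hyps(2) by (metis nat.distinct(1) sum.neutral)
  then obtain n where n: "r k = Suc n" by (cases "r k") auto
  let ?n = "\<lambda>r. \<Prod>j\<in>UNIV. of_nat (fact (r j)) * pairing a (u j) (u j) ^ r j"
  let ?r = "r(k := n)" and ?s = "s(k := s k - 1)"
  have split: "sum t UNIV = t k + sum t (UNIV - {k})" for t :: "'a \<Rightarrow> nat"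
    by (rule sum.remove) simp_all
  \<comment> \<open>One factor \<open>lin_form (u k)\<close> is split off on the left and moved to
    the right as its dual derivation, which lowers both degrees by one.\<close>
  have step: "mono_form a (lin_prod u r) (lin_prod u s) =
      of_nat (s k) * pairing a (u k) (u k) * mono_form a (lin_prod u ?r) (lin_prod u ?s)"
    by (simp add: lin_prod_Suc[of r k n, OF n] mono_form_lin_form_mult dual_diff_lin_prod[of a u, OF orth]
      mono_form_const_mult_right)
  show ?case
  proof (cases "s k")
    \<comment> \<open>The derivation produces the factor \<open>s k = 0\<close>, and
      \<open>r\<close> differs from \<open>s\<close> at \<open>k\<close>.\<close>
    case 0
    then show ?thesis using n by (auto simp: step)
  next
    case (Suc l)
    have "N = sum ?r UNIV" "sum ?r UNIV = sum ?s UNIV"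
      using Suc.hyps(2) Suc.prems n Suc split[of r] split[of s] split[of ?r] split[of ?s] by simp_all
    from Suc.hyps(1)[OF this] have "mono_form a (lin_prod u ?r) (lin_prod u ?s) =
      (if ?r = ?s then ?n ?r else 0)" .
    \<comment> \<open>Both entries at \<open>k\<close> are positive, so lowering them by one loses
      no information.\<close>
    moreover have "?r = ?s \<longleftrightarrow> r = s"
      using n Suc by (metis diff_Suc_1 fun_upd_triv fun_upd_upd fun_upd_same)
    moreover have "?n r = of_nat (Suc n) * pairing a (u k) (u k) * ?n ?r"
      by (simp add: prod.remove[of UNIV k] n algebra_simps)
    ultimately show ?thesis using n Suc by (auto simp: step)
  qed
qed

section \<open>The degree one case\<close>

lemma UNIV_indet: "(UNIV :: indet set) = {VX, VY, VZ}"
  using indet.exhaust by blast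

instance indet :: finite
  by standard (unfold UNIV_indet, simp)

text \<open>\<open>indet\<close> also serves as the index set of the three transformed linear forms,
  so exponent triples and coefficient rows alike become functions on \<open>indet\<close>.\<close>

primrec triple :: "'b \<Rightarrow> 'b \<Rightarrow> 'b \<Rightarrow> indet \<Rightarrow> 'b" where
  "triple x y z VX = x"
| "triple x y z VY = y"
| "triple x y z VZ = z"

lemma triple_eq_iff: "triple x y z = triple x' y' z' \<longleftrightarrow> (x, y, z) = (x', y', z')"
  by (metis triple.simps prod.inject)

lemma sum_indet: "(\<Sum>i\<in>UNIV. f i) = f VX + f VY + f VZ"
  by (simp add: UNIV_indet add.assoc)

lemma prod_indet: "(\<Prod>i\<in>UNIV. f i) = f VX * f VY * f VZ"
  by (simp add: UNIV_indet mult.assoc)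

section \<open>Homogeneity of monomials in linear forms\<close>

lemma homog_mult: "f \<in> homog m \<Longrightarrow> g \<in> homog n \<Longrightarrow> f * g \<in> homog (m + n)"
  using keys_mult[of f g] by (fastforce simp: homog_def lookup_add)

lemma homog_one: "1 \<in> homog 0"
  by (simp add: homog_def)

lemma homog_power: "f \<in> homog m \<Longrightarrow> f ^ n \<in> homog (n * m)"
  by (induction n) (simp_all add: homog_one homog_mult)

lemma var_eq_indet_poly: "var = indet_poly"
  by (simp add: fun_eq_iff var_def indet_poly_def)

lemma homog_lin_form: "lin_form u \<in> homog 1"
proof -
  have "indet_poly i \<in> homog 1" for i
    by (cases i) (simp_all add: homog_def indet_poly_def lookup_single)
  then show ?thesis
    by (simp add: lin_form_def sum_indet var_eq_indet_poly homog_add homog_const_mult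
      flip: const_poly_def)
qed

text \<open>Needed because the given form is determined only on \<open>homog N\<close>.\<close>

lemma lin_prod_homog:
  fixes u :: "indet \<Rightarrow> indet \<Rightarrow> complex"
  shows "lin_prod u r \<in> homog (sum r UNIV)"
  using homog_mult[OF homog_mult] homog_power[OF homog_lin_form]
  by (simp add: lin_prod_def sum_indet prod_indet)

section \<open>Scalar products of the transformed variables\<close>

context
  fixes p1 p2 p3 p4 :: complex
  assumes nz: "p1 \<noteq> 0" "p2 \<noteq> 0" "p3 \<noteq> 0" "p4 \<noteq> 0"
    "p1 + p2 \<noteq> 0" "p1 + p3 \<noteq> 0" "p2 + p4 \<noteq> 0" "p3 + p4 \<noteq> 0"
    "p1 + p2 + p3 + p4 \<noteq> 0" "p1 * p4 - p2 * p3 \<noteq> 0"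
begin

definition weights :: "indet \<Rightarrow> complex" where
  "weights = triple (theta p1 p2 p3 p4 / teta0 p1 p2 p3 p4) (theta p1 p2 p3 p4 / teta1 p1 p2 p3 p4)
    (theta p1 p2 p3 p4 / teta2 p1 p2 p3 p4)"

text \<open>The factor depending only on the column \<open>i\<close> is kept apart: in a scalar
  product it occurs twice and cancels the denominator of \<open>weights i\<close> once.\<close>

definition coeffs :: "indet \<Rightarrow> indet \<Rightarrow> complex" where
  "coeffs j i = ttheta p1 p2 p3 p4 *
    (triple (\<lambda>_. 1) (triple 1 (1 - par_t p1 p2 p3 p4) (1 - par_v p1 p2 p3 p4))
       (triple 1 (1 - par_u p1 p2 p3 p4) (1 - par_w p1 p2 p3 p4)) j i *
     triple (teta0 p1 p2 p3 p4) (teta1 p1 p2 p3 p4) (teta2 p1 p2 p3 p4) i)"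

lemma tx_eq: "tx p1 p2 p3 p4 = lin_form (coeffs VX)"
  and ty_eq: "ty p1 p2 p3 p4 = lin_form (coeffs VY)"
  and tz_eq: "tz p1 p2 p3 p4 = lin_form (coeffs VZ)"
  by (simp_all add: tx_def ty_def tz_def lin_form_def coeffs_def var_eq_indet_poly sum_indet
    const_poly_def distrib_left single_zero_mult_mult)

text \<open>The first numerator is p1 S - (p1 + p2)(p1 + p3) = p1 p4 - p2 p3, with S the sum of the
  four parameters; permuting the parameters gives the others up to sign.\<close>

lemma one_minus_par:
  "1 - par_t p1 p2 p3 p4 = (p1*p4 - p2*p3) / (p1*(p1 + p2 + p3 + p4))"
  "1 - par_u p1 p2 p3 p4 = - (p1*p4 - p2*p3) / (p3*(p1 + p2 + p3 + p4))"
  "1 - par_v p1 p2 p3 p4 = - (p1*p4 - p2*p3) / (p2*(p1 + p2 + p3 + p4))"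
  "1 - par_w p1 p2 p3 p4 = (p1*p4 - p2*p3) / (p4*(p1 + p2 + p3 + p4))"
  unfolding par_t_def par_u_def par_v_def par_w_def
  using nz by (simp_all add: eq_divide_eq diff_divide_eq_iff, simp_all add: algebra_simps)

lemma teta_neq_0: "teta0 p1 p2 p3 p4 \<noteq> 0" "teta1 p1 p2 p3 p4 \<noteq> 0" "teta2 p1 p2 p3 p4 \<noteq> 0"
  using nz by (simp_all add: teta0_def teta1_def teta2_def nu_def)

lemma theta_mult_ttheta: "theta p1 p2 p3 p4 * ttheta p1 p2 p3 p4 = nu p1 p2 p3 p4"
  by (simp add: theta_def ttheta_def nu_def power2_eq_square) (simp add: algebra_simps)

text \<open>The Gram matrix of the three transformed variables with the common factor
  \<open>theta * ttheta ^ 2\<close> removed; since \<open>theta * ttheta = nu\<close>, a factor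
  \<open>nu\<close> appears on the right.\<close>

lemma teta_sums:
  defines "e0 \<equiv> teta0 p1 p2 p3 p4" and "e1 \<equiv> teta1 p1 p2 p3 p4" and "e2 \<equiv> teta2 p1 p2 p3 p4"
    and "n \<equiv> nu p1 p2 p3 p4"
    and "t \<equiv> 1 - par_t p1 p2 p3 p4" and "u \<equiv> 1 - par_u p1 p2 p3 p4"
    and "v \<equiv> 1 - par_v p1 p2 p3 p4" and "w \<equiv> 1 - par_w p1 p2 p3 p4"
  shows "e0 + e1 + e2 = 1 / (n * eta0 p1 p2 p3 p4)"
    "e0 + t * e1 + v * e2 = 0"
    "e0 + u * e1 + w * e2 = 0"
    "e0 + t * u * e1 + v * w * e2 = 0"
    "e0 + t * t * e1 + v * v * e2 = 1 / (n * eta1 p1 p2 p3 p4)"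
    "e0 + u * u * e1 + w * w * e2 = 1 / (n * eta2 p1 p2 p3 p4)"
proof -
  define A B C D S E where eqs: "A = p1 + p2" "B = p1 + p3" "C = p2 + p4" "D = p3 + p4"
    "S = p1 + p2 + p3 + p4" "E = p1 * p4 - p2 * p3"
  have nz: "p1 \<noteq> 0" "p2 \<noteq> 0" "p3 \<noteq> 0" "p4 \<noteq> 0" "A \<noteq> 0" "B \<noteq> 0" "C \<noteq> 0" "D \<noteq> 0" "S \<noteq> 0" "E \<noteq> 0"
    using nz by (simp_all add: eqs)
  have defs: "e0 = E\<^sup>2 / (A * B * C * D)" "e1 = p1 * p3 * S / (A * B * D)"
    "e2 = p2 * p4 * S / (A * C * D)" "n = A * B * C * D / E\<^sup>2"
    "t = E / (p1 * S)" "u = - E / (p3 * S)" "v = - E / (p2 * S)" "w = E / (p4 * S)"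
    unfolding e0_def e1_def e2_def n_def t_def u_def v_def w_def one_minus_par eqs
      teta0_def teta1_def teta2_def nu_def
    by (simp_all add: mult_ac)
  have etas: "eta0 p1 p2 p3 p4 = inverse n" "eta1 p1 p2 p3 p4 = p1 * p2 * S / (A * B * C)"
    "eta2 p1 p2 p3 p4 = p3 * p4 * S / (B * C * D)"
    by (simp_all add: eta0_def eta1_def eta2_def eqs n_def mult_ac)
  \<comment> \<open>The numerators of the six sums over a common denominator, up to powers of
    \<open>E\<close>. Only here do the relations between the abbreviations enter; the fraction
    computations below treat them as independent.\<close>
  have I: "E\<^sup>2 + p1 * p3 * S * C + p2 * p4 * S * B = A * B * C * D"
    "E + p3 * C - p4 * B = 0"
    "E - p1 * C + p2 * B = 0"
    "S - C - B = 0"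
    "p1 * p2 * S + p2 * p3 * C + p1 * p4 * B = A * B * C"
    "p3 * p4 * S + p1 * p4 * C + p2 * p3 * B = B * C * D"
    unfolding eqs by algebra+
  have "e0 + e1 + e2 = (E\<^sup>2 + p1 * p3 * S * C + p2 * p4 * S * B) / (A * B * C * D)"
    using nz by (simp add: defs divide_simps)
  then show "e0 + e1 + e2 = 1 / (n * eta0 p1 p2 p3 p4)"
    unfolding I etas using nz by (simp add: defs)
  have "e0 + t * e1 + v * e2 = E * (E + p3 * C - p4 * B) / (A * B * C * D)"
    using nz by (simp add: defs divide_simps) algebra
  then show "e0 + t * e1 + v * e2 = 0"
    using I by simp
  have "e0 + u * e1 + w * e2 = E * (E - p1 * C + p2 * B) / (A * B * C * D)"
    using nz by (simp add: defs divide_simps) algebra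
  then show "e0 + u * e1 + w * e2 = 0"
    using I by simp
  have "e0 + t * u * e1 + v * w * e2 = E\<^sup>2 * (S - C - B) / (S * A * B * C * D)"
    using nz by (simp add: defs divide_simps) algebra
  then show "e0 + t * u * e1 + v * w * e2 = 0"
    using I by simp
  have "e0 + t * t * e1 + v * v * e2 =
      E\<^sup>2 * (p1 * p2 * S + p2 * p3 * C + p1 * p4 * B) / (p1 * p2 * S * A * B * C * D)"
    using nz by (simp add: defs divide_simps) algebra
  then show "e0 + t * t * e1 + v * v * e2 = 1 / (n * eta1 p1 p2 p3 p4)"
    unfolding I etas using nz by (simp add: defs)
  have "e0 + u * u * e1 + w * w * e2 =
      E\<^sup>2 * (p3 * p4 * S + p1 * p4 * C + p2 * p3 * B) / (p3 * p4 * S * A * B * C * D)"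
    using nz by (simp add: defs divide_simps) algebra
  then show "e0 + u * u * e1 + w * w * e2 = 1 / (n * eta2 p1 p2 p3 p4)"
    unfolding I etas using nz by (simp add: defs)
qed

lemma pairing_coeffs:
  "pairing weights (coeffs j) (coeffs k) =
    (if j = k then ttheta p1 p2 p3 p4 / triple (eta0 p1 p2 p3 p4) (eta1 p1 p2 p3 p4) (eta2 p1 p2 p3 p4) j
     else 0)"
proof -
  have nu: "nu p1 p2 p3 p4 \<noteq> 0"
    using nz by (simp add: nu_def)
  define c where "c = triple (\<lambda>_. 1) (triple 1 (1 - par_t p1 p2 p3 p4) (1 - par_v p1 p2 p3 p4))
      (triple 1 (1 - par_u p1 p2 p3 p4) (1 - par_w p1 p2 p3 p4))"
  define q where "q = teta0 p1 p2 p3 p4 * c j VX * c k VX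
    + c j VY * c k VY * teta1 p1 p2 p3 p4 + c j VZ * c k VZ * teta2 p1 p2 p3 p4"
  have "pairing weights (coeffs j) (coeffs k) =
      (theta p1 p2 p3 p4 * ttheta p1 p2 p3 p4) * ttheta p1 p2 p3 p4 * q"
    using teta_neq_0
    by (simp add: pairing_def sum_indet weights_def coeffs_def q_def c_def distrib_left mult_ac)
  also have "\<dots> = nu p1 p2 p3 p4 * ttheta p1 p2 p3 p4 * q"
    unfolding theta_mult_ttheta ..
  also have "q = (if j = k then 1 / (nu p1 p2 p3 p4 *
      triple (eta0 p1 p2 p3 p4) (eta1 p1 p2 p3 p4) (eta2 p1 p2 p3 p4) j) else 0)"
    \<comment> \<open>By symmetry in \<open>j\<close> and \<open>k\<close> the nine cases reduce to
      the six sums.\<close>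
    using teta_sums by (cases j; cases k) (simp_all add: q_def c_def mult_ac)
  finally show ?thesis
    using nu by simp
qed

text \<open>Distributing the N-th power of \<open>theta\<close> over the three variables, as r + s +
  t = N, turns the prescribed squared lengths into \<open>mono_weight weights\<close>.\<close>

lemma is_the_form_mono_form: "is_the_form p1 p2 p3 p4 N (mono_form weights)"
proof -
  have single: "mono_form weights (Poly_Mapping.single (expo r s t) 1) (Poly_Mapping.single (expo r' s' t') 1) =
      (if (r, s, t) = (r', s', t') then mono_weight weights (expo r s t) else 0)" for r s t r' s' t'
    by (auto simp: mono_form_def lookup_single when_def expo_eq_iff)
  have weight: "mono_weight weights (expo r s t) =
      fact r * fact s * fact t / (teta0 p1 p2 p3 p4 ^ r * teta1 p1 p2 p3 p4 ^ s * teta2 p1 p2 p3 p4 ^ t)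
        * theta p1 p2 p3 p4 ^ (r + s + t)" for r s t
    by (simp add: mono_weight_def weights_def prod_indet lookup_expo power_divide power_add)
  have "mono_form weights (f + g) h = mono_form weights f h + mono_form weights g h" for f g h
    by (simp add: mono_form_commute[of _ _ h] mono_form_add_right)
  moreover have "mono_form weights (const_poly c * f) g = c * mono_form weights f g" for c f g
    by (simp add: mono_form_commute[of _ _ g] const_poly_def mono_form_const_mult_right)
  moreover have "mono_form weights f g = mono_form weights g f" for f g
    by (rule mono_form_commute)
  ultimately show ?thesis
    unfolding is_the_form_def sym_bilinear_on_def monomial_eq by (auto simp: single weight)
qed

end

theorem lemma4p1:
  fixes p1 p2 p3 p4 :: complex
    and N :: nat
    and B :: "poly3 \<Rightarrow> poly3 \<Rightarrow> complex"
  assumes "p1 \<noteq> 0" and "p2 \<noteq> 0" and "p3 \<noteq> 0" and "p4 \<noteq> 0"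
    and "p1 + p2 \<noteq> 0" and "p1 + p3 \<noteq> 0" and "p2 + p4 \<noteq> 0" and "p3 + p4 \<noteq> 0"
    and "p1 + p2 + p3 + p4 \<noteq> 0"
    and "p1 * p4 - p2 * p3 \<noteq> 0"
    and "is_the_form p1 p2 p3 p4 N B"
  shows "(\<forall>r s t r' s' t'. r + s + t = N \<longrightarrow> r' + s' + t' = N \<longrightarrow> (r, s, t) \<noteq> (r', s', t') \<longrightarrow>
            B (tx p1 p2 p3 p4 ^ r * ty p1 p2 p3 p4 ^ s * tz p1 p2 p3 p4 ^ t)
              (tx p1 p2 p3 p4 ^ r' * ty p1 p2 p3 p4 ^ s' * tz p1 p2 p3 p4 ^ t') = 0) \<and>
         (\<forall>r s t. r + s + t = N \<longrightarrow>
            B (tx p1 p2 p3 p4 ^ r * ty p1 p2 p3 p4 ^ s * tz p1 p2 p3 p4 ^ t)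
              (tx p1 p2 p3 p4 ^ r * ty p1 p2 p3 p4 ^ s * tz p1 p2 p3 p4 ^ t) =
              fact r * fact s * fact t
              / (eta0 p1 p2 p3 p4 ^ r * eta1 p1 p2 p3 p4 ^ s * eta2 p1 p2 p3 p4 ^ t)
              * ttheta p1 p2 p3 p4 ^ N)"
proof -
  have nz: "p1 \<noteq> 0" "p2 \<noteq> 0" "p3 \<noteq> 0" "p4 \<noteq> 0" "p1 + p2 \<noteq> 0" "p1 + p3 \<noteq> 0" "p2 + p4 \<noteq> 0"
    "p3 + p4 \<noteq> 0" "p1 + p2 + p3 + p4 \<noteq> 0" "p1 * p4 - p2 * p3 \<noteq> 0"
    by (fact assms)+
  let ?c = "coeffs p1 p2 p3 p4"
  let ?v = "\<lambda>r s t. tx p1 p2 p3 p4 ^ r * ty p1 p2 p3 p4 ^ s * tz p1 p2 p3 p4 ^ t"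
  have v: "?v r s t = lin_prod ?c (triple r s t)" for r s t
    by (simp add: lin_prod_def prod_indet tx_eq[OF nz] ty_eq[OF nz] tz_eq[OF nz])
  have homog: "?v r s t \<in> homog N" if "r + s + t = N" for r s t
    unfolding v using lin_prod_homog[of ?c "triple r s t"] that by (simp add: sum_indet)
  have "B (?v r s t) (?v r' s' t') =
      (if (r, s, t) = (r', s', t') then fact r * fact s * fact t
         / (eta0 p1 p2 p3 p4 ^ r * eta1 p1 p2 p3 p4 ^ s * eta2 p1 p2 p3 p4 ^ t) * ttheta p1 p2 p3 p4 ^ N
       else 0)" if "r + s + t = N" "r' + s' + t' = N" for r s t r' s' t'
  proof -
    \<comment> \<open>Uniqueness on \<open>homog N\<close> replaces the given form by the explicit
      one, to which the general orthogonality result applies.\<close>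
    have "B (?v r s t) (?v r' s' t') = mono_form (weights p1 p2 p3 p4) (?v r s t) (?v r' s' t')"
      by (intro is_the_form_unique[OF assms(11) is_the_form_mono_form[OF nz]] homog that)
    also have "\<dots> = (if triple r s t = triple r' s' t' then
        \<Prod>j\<in>UNIV. of_nat (fact (triple r s t j)) *
          pairing (weights p1 p2 p3 p4) (?c j) (?c j) ^ triple r s t j else 0)"
      unfolding v by (rule mono_form_lin_prod) (use that in \<open>simp_all add: pairing_coeffs[OF nz] sum_indet\<close>)
    finally show ?thesis
      by (simp add: triple_eq_iff prod_indet pairing_coeffs[OF nz] power_divide power_add
        flip: that(1))
  qed
  then show ?thesis by simp
qed

end
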